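(* Let $(A,T)$ be a topological algebra with unit $e$. The following assertions are equivalent: (1) $(A,T)$ is a uniform topological algebra; (2) the topology $T$ is defined by a family $\{p_s : s\in S\}$ of submultiplicative seminorms such that (i) $p_s(e)=1$ for all $s\in S$; (ii) for all $x\in A$ and $s\in S$ with $p_s(x)=1$, there exists $f_0\in M_s(A)$ such that $|f_0(x)|=1$.
   Context: A topological algebra is an (associative, not necessarily commutative) algebra over $\mathbb{C}$ which is also a Hausdorff topological vector space such that the multiplication is separately continuous. A uniform seminorm on an algebra $A$ is a seminorm $p$ with $p(x^2)=p(x)^2$ for all $x\in A$. A uniform topological algebra is a topological algebra whose topology is determined by a family of uniform seminorms. $M(A)$ denotes the set of nonzero continuous multiplicative linear functionals $A\to\mathbb{C}$. Given a family $\{p_s: s\in S\}$ of submultiplicative seminorms defining the topology of $A$, for each $s\in S$ put $M_s(A)=\{f\in M(A): |f(x)|\le p_s(x)\text{ for all }x\in A\}$. *)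

theory Defs
  imports "HOL-Analysis.Analysis"
begin

text \<open>
  An algebra over the complex numbers is a ring type together with a scalar
  multiplication. The class \<^class>\<open>ring\<close> is used rather than \<^class>\<open>ring_1\<close>, because the
  latter would exclude the zero algebra; units are treated as explicit elements.
\<close>

locale complex_algebra = vector_space smul
  for smul :: "complex \<Rightarrow> 'a::ring \<Rightarrow> 'a" +
  assumes smul_mult_left: "smul c (x * y) = smul c x * y"
    and smul_mult_right: "smul c (x * y) = x * smul c y"

locale topological_algebra = complex_algebra smul
  for smul :: "complex \<Rightarrow> 'a::ring \<Rightarrow> 'a" +
  fixes T :: "'a topology"
  assumes topspace_UNIV: "topspace T = UNIV"
    and Hausdorff: "Hausdorff_space T"
    and continuous_add: "continuous_map (prod_topology T T) T (\<lambda>(x, y). x + y)"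
    and continuous_smul: "continuous_map (prod_topology euclidean T) T (\<lambda>(c, x). smul c x)"
    and continuous_mult_left: "continuous_map T T (\<lambda>x. a * x)"
    and continuous_mult_right: "continuous_map T T (\<lambda>x. x * a)"

definition seminorm :: "(complex \<Rightarrow> 'a::ring \<Rightarrow> 'a) \<Rightarrow> ('a \<Rightarrow> real) \<Rightarrow> bool" where
  "seminorm smul p \<longleftrightarrow>
     (\<forall>x. 0 \<le> p x) \<and>
     (\<forall>x y. p (x + y) \<le> p x + p y) \<and>
     (\<forall>c x. p (smul c x) = cmod c * p x)"

definition submultiplicative_seminorm :: "(complex \<Rightarrow> 'a::ring \<Rightarrow> 'a) \<Rightarrow> ('a \<Rightarrow> real) \<Rightarrow> bool" where
  "submultiplicative_seminorm smul p \<longleftrightarrow>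
     seminorm smul p \<and> (\<forall>x y. p (x * y) \<le> p x * p y)"

definition uniform_seminorm :: "(complex \<Rightarrow> 'a::ring \<Rightarrow> 'a) \<Rightarrow> ('a \<Rightarrow> real) \<Rightarrow> bool" where
  "uniform_seminorm smul p \<longleftrightarrow>
     seminorm smul p \<and> (\<forall>x. p (x * x) = (p x)\<^sup>2)"

text \<open>
  The topology defined by a family of seminorms has the open balls as a subbase.
  The whole space is added to the subbase only for the sake of the empty family,
  which is to define the indiscrete topology on the type. Families are represented
  as sets of seminorms, indexed by themselves.
\<close>

definition seminorm_topology :: "('a::ring \<Rightarrow> real) set \<Rightarrow> 'a topology" where
  "seminorm_topology P =
     topology_generated_by (insert UNIV {{y. p (y - x) < r} | p x r. p \<in> P \<and> 0 < r})"

definition uniform_topological_algebra ::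
    "(complex \<Rightarrow> 'a::ring \<Rightarrow> 'a) \<Rightarrow> 'a topology \<Rightarrow> bool" where
  "uniform_topological_algebra smul T \<longleftrightarrow>
     topological_algebra smul T \<and>
     (\<exists>P. (\<forall>p\<in>P. uniform_seminorm smul p) \<and> T = seminorm_topology P)"

definition characters :: "(complex \<Rightarrow> 'a::ring \<Rightarrow> 'a) \<Rightarrow> 'a topology \<Rightarrow> ('a \<Rightarrow> complex) set" where
  "characters smul T =
     {f. Vector_Spaces.linear smul (*) f \<and>
         (\<forall>x y. f (x * y) = f x * f y) \<and>
         continuous_map T euclidean f \<and>
         (\<exists>x. f x \<noteq> 0)}"

definition characters_bounded_by ::
    "(complex \<Rightarrow> 'a::ring \<Rightarrow> 'a) \<Rightarrow> 'a topology \<Rightarrow> ('a \<Rightarrow> real) \<Rightarrow> ('a \<Rightarrow> complex) set" where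
  "characters_bounded_by smul T p = {f \<in> characters smul T. \<forall>x. cmod (f x) \<le> p x}"

end

theory Submission
  imports Defs
begin

text \<open>
  No completion is needed. For a seminorm with \<open>p (x\<^sup>2) = p (x)\<^sup>2\<close>, the Jordan product is bounded
  by polarisation, then \<open>x y x\<close> and, through its square, the commutator \<open>x y - y x\<close>; hence
  \<open>p (x y) \<le> 6 p (x) p (y)\<close>. Comparing the \<open>2\<^sup>k\<close>-th powers of \<open>x y\<close> and \<open>y x\<close> gives
  \<open>p (x y) = p (y x)\<close>, so conjugation by an approximate exponential is bounded and a Liouville
  argument shows that \<open>p\<close> vanishes on commutators. Taking \<open>2\<^sup>k\<close>-th powers again removes the
  constant \<open>6\<close>.

  To find a character norming \<open>x\<close>, take a minimal uniform seminorm \<open>q \<le> p\<close> subject to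
  \<open>q (y) \<le> q (x y)\<close> for all \<open>y\<close>. Minimality makes \<open>q\<close> multiplicative, because
  \<open>lim q (y z\<^sup>n) / q (z)\<^sup>n\<close> is again admissible; by Gelfand--Mazur the quotient by the null space
  of \<open>q\<close> is the complex field, and \<open>q\<close> is the modulus of a character.
\<close>

section \<open>Algebras with an explicit unit\<close>

locale unital_complex_algebra = complex_algebra smul
  for smul :: "complex \<Rightarrow> 'a::ring \<Rightarrow> 'a" +
  fixes e :: 'a
  assumes unit_left: "e * x = x"
    and unit_right: "x * e = x"
begin

sublocale unital: monoid_mult e "(*)"
  by unfold_locales (simp_all add: unit_left unit_right mult.assoc)

abbreviation upower :: "'a \<Rightarrow> nat \<Rightarrow> 'a" (infixr "\<up>" 80)
  where "x \<up> n \<equiv> power.power e (*) x n"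

lemmas smul_mult = smul_mult_left [symmetric] smul_mult_right [symmetric]

lemma upower_mult_commuting:
  assumes "u * v = v * u"
  shows "(u * v) \<up> n = u \<up> n * v \<up> n"
proof (induction n)
  case (Suc n)
  have "u \<up> n * v = v * u \<up> n"
    by (rule unital.power_commuting_commutes [OF assms])
  then have "u * v * (u \<up> n * v \<up> n) = u * u \<up> n * (v * v \<up> n)"
    by (metis mult.assoc)
  with Suc show ?case by simp
qed simp

lemma upower_swap: "(x * y) \<up> Suc n = x * ((y * x) \<up> n * y)"
proof (induction n)
  case (Suc n)
  have "(x * y) \<up> Suc (Suc n) = (x * y) * (x * ((y * x) \<up> n * y))"
    using Suc by simp
  also have "\<dots> = x * ((y * x) \<up> Suc n * y)"
    by (simp add: mult.assoc)
  finally show ?case .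
qed simp

end

text \<open>Otherwise \<open>(b / a) ^ (2 ^ k)\<close> tends to 0, whereas the hypothesis keeps
  \<open>C\<close> times it at least 1. The exponents are powers of two because uniform seminorms
  are exact on such powers.\<close>

lemma le_if_power_le_const_mult:
  fixes a b C :: real
  assumes "0 \<le> b" and le: "\<And>k. a ^ (2 ^ k) \<le> C * b ^ (2 ^ k)"
  shows "a \<le> b"
proof (rule ccontr)
  assume "\<not> a \<le> b"
  then have ab: "b < a" "0 < a" using \<open>0 \<le> b\<close> by auto
  have "(\<lambda>n. (b / a) ^ n) \<longlonglongrightarrow> 0"
    using ab \<open>0 \<le> b\<close> by (intro LIMSEQ_realpow_zero) auto
  then have "((\<lambda>n. (b / a) ^ n) \<circ> (\<lambda>k. 2 ^ k)) \<longlonglongrightarrow> 0"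
    by (rule LIMSEQ_subseq_LIMSEQ) (simp add: strict_mono_def)
  then have "(\<lambda>k. C * (b / a) ^ (2 ^ k)) \<longlonglongrightarrow> C * 0"
    unfolding comp_def by (rule tendsto_mult_left)
  moreover have "1 \<le> C * (b / a) ^ (2 ^ k)" for k
    using le [of k] ab by (simp add: power_divide field_simps)
  ultimately have "1 \<le> C * 0"
    using LIMSEQ_le_const by blast
  then show False by simp
qed

lemma nonpos_if_le_inverse_square:
  fixes c d :: real
  assumes "\<And>n. c \<le> (d / real (Suc n))\<^sup>2"
  shows "c \<le> 0"
proof -
  have "(\<lambda>n. (d / real (Suc n))\<^sup>2) \<longlonglongrightarrow> 0\<^sup>2"
    by (intro tendsto_intros LIMSEQ_Suc [OF lim_const_over_n])
  then have "c \<le> 0\<^sup>2"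
    by (rule LIMSEQ_le_const) (use assms in blast)
  then show ?thesis by simp
qed

section \<open>Seminorms on an algebra\<close>

locale algebra_seminorm = unital_complex_algebra smul e
  for smul :: "complex \<Rightarrow> 'a::ring \<Rightarrow> 'a" and e +
  fixes p :: "'a \<Rightarrow> real"
  assumes seminorm: "seminorm smul p"
begin

lemma nonneg [simp]: "0 \<le> p x"
  and triangle: "p (x + y) \<le> p x + p y"
  and homogeneous: "p (smul c x) = cmod c * p x"
  using seminorm by (auto simp: seminorm_def)

lemma zero [simp]: "p 0 = 0"
  using homogeneous [of 0 0] by simp

lemma minus [simp]: "p (- x) = p x"
  using homogeneous [of "- 1" x] by simp

lemma minus_commute: "p (x - y) = p (y - x)"
  using minus [of "x - y"] by simp

lemma triangle_diff: "p (x - y) \<le> p x + p y"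
  using triangle [of x "- y"] by simp

lemma double: "p (x + x) = 2 * p x"
proof -
  have "x + x = smul 2 x"
    using scale_left_distrib [of 1 1 x] by simp
  then show ?thesis by (simp add: homogeneous)
qed

lemma eq_if_diff_null:
  assumes "p (x - y) = 0" shows "p x = p y"
  using triangle [of "x - y" y] triangle [of "y - x" x] assms minus_commute [of x y] by simp

lemma sum_le: "p (\<Sum>i\<in>I. g i) \<le> (\<Sum>i\<in>I. p (g i))"
proof (induction I rule: infinite_finite_induct)
  case (insert i I)
  then show ?case using triangle [of "g i" "sum g I"] by simp
qed auto

text \<open>The operator \<open>1 + z D\<close> acts on polynomials with coefficients in the algebra
  by adding \<open>D (c i)\<close> in degree \<open>i + 1\<close>. The coefficients of degree 0 and
  1 are recorded because Cauchy's estimate will be applied to the linear one.\<close>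

lemma polynomial_affine_step:
  assumes c: "\<And>j. j \<ge> N \<Longrightarrow> c j = 0" "\<And>z. F z = (\<Sum>j<N. smul (z ^ j) (c j))"
    and D: "\<And>u w. D (u + w) = D u + D w" "\<And>b w. D (smul b w) = smul b (D w)"
  obtains c' where "\<And>j. j \<ge> Suc N \<Longrightarrow> c' j = 0" "c' 0 = c 0" "c' 1 = c 1 + D (c 0)"
    "\<And>z. F z + smul z (D (F z)) = (\<Sum>j<Suc N. smul (z ^ j) (c' j))"
proof
  let ?c = "\<lambda>j. c j + (case j of 0 \<Rightarrow> 0 | Suc i \<Rightarrow> D (c i))"
  have D0: "D 0 = 0" using D(2) [of 0 0] by simp
  have Dsum: "D (\<Sum>j<n. w j) = (\<Sum>j<n. D (w j))" for w and n :: nat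
    by (induction n) (simp_all add: D0 D)
  show "?c j = 0" if "j \<ge> Suc N" for j
    using that c(1) D0 by (cases j) auto
  fix z
  have "(\<Sum>j<Suc N. smul (z ^ j) (?c j)) =
      (\<Sum>j<Suc N. smul (z ^ j) (c j)) + (\<Sum>j<N. smul (z ^ Suc j) (D (c j)))"
    unfolding scale_right_distrib sum.distrib
    using sum.lessThan_Suc_shift [of "\<lambda>j. smul (z ^ j) (case j of 0 \<Rightarrow> 0 | Suc i \<Rightarrow> D (c i))" N]
    by simp
  then show "F z + smul z (D (F z)) = (\<Sum>j<Suc N. smul (z ^ j) (?c j))"
    by (simp add: c Dsum D scale_sum_right)
qed auto

text \<open>Cauchy's estimate, by averaging over the \<open>M\<close>-th roots of unity.\<close>

lemma coefficient_bound:
  assumes F: "\<And>z. F z = (\<Sum>k<M. smul (z ^ k) (c k))" and M: "2 \<le> M" and R: "0 \<le> R"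
    and bound: "\<And>z. cmod z = R \<Longrightarrow> p (F z) \<le> B"
  shows "R * p (c 1) \<le> B"
proof -
  define w where "w = exp (2 * of_real pi * \<i> * of_nat 1 / of_nat M)"
  have w_power: "w ^ n = exp (2 * of_real pi * \<i> * of_nat n / of_nat M)" for n
    by (simp add: w_def exp_of_nat_mult [symmetric] mult_ac)
  have norm_w: "cmod w = 1" by (simp add: w_def)
  \<comment> \<open>\<open>w\<close> is a primitive \<open>M\<close>-th root of unity, so
    \<open>M - 1\<close> stands for the exponent \<open>-1\<close> and \<open>k + (M - 1)\<close>
    for \<open>k - 1\<close>; the sum filters out every \<open>k\<close> except 1.\<close>
  have sum_w: "(\<Sum>j<M. (w ^ (k + (M - 1))) ^ j) = (if k = 1 then of_nat M else 0)" if "k < M" for k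
  proof -
    have dvd: "M dvd k + (M - 1) \<longleftrightarrow> k = 1"
    proof
      assume "M dvd k + (M - 1)"
      then obtain q where q: "k + (M - 1) = M * q" by (auto simp: dvd_def)
      moreover have "q < 2"
      proof (rule ccontr)
        assume "\<not> q < 2"
        then have "M * 2 \<le> M * q" by (intro mult_le_mono2) simp
        then show False using q that by linarith
      qed
      ultimately show "k = 1" using M by (cases "q = 0") (auto simp: less_2_cases_iff)
    qed (use M in simp)
    have root: "(w ^ n) ^ M = 1" for n
      using complex_root_unity_eq_1 [of M "n * M"] M w_power [of "n * M"] by (simp add: power_mult)
    show ?thesis
    proof (cases "k = 1")
      case True
      then have "w ^ (k + (M - 1)) = 1"
        using root [of 1] M by (simp flip: power_Suc)
      then show ?thesis using True by (simp only: power_one) simp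
    next
      case False
      then have "w ^ (k + (M - 1)) \<noteq> 1"
        unfolding w_power using dvd complex_root_unity_eq_1 [of M "k + (M - 1)"] M by linarith
      then show ?thesis using False by (simp only: sum_gp_strict root) simp
    qed
  qed
  let ?S = "\<Sum>j<M. smul (w ^ (j * (M - 1))) (F (of_real R * w ^ j))"
  have "w ^ (j * (M - 1)) * (of_real R * w ^ j) ^ k = of_real R ^ k * (w ^ (k + (M - 1))) ^ j" for j k
    by (simp only: power_mult_distrib power_add power_mult [symmetric] mult_ac)
  then have "?S = (\<Sum>j<M. \<Sum>k<M. smul (of_real R ^ k * (w ^ (k + (M - 1))) ^ j) (c k))"
    by (simp only: F scale_sum_right scale_scale)
  also have "\<dots> = (\<Sum>k<M. smul (of_real R ^ k * (\<Sum>j<M. (w ^ (k + (M - 1))) ^ j)) (c k))"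
    by (subst sum.swap) (simp add: scale_sum_left sum_distrib_left)
  also have "\<dots> = (\<Sum>k<M. if k = 1 then smul (of_real R * of_nat M) (c 1) else 0)"
  proof (intro sum.cong refl)
    fix k assume "k \<in> {..<M}"
    then have "k < M" by simp
    show "smul (of_real R ^ k * (\<Sum>j<M. (w ^ (k + (M - 1))) ^ j)) (c k) =
        (if k = 1 then smul (of_real R * of_nat M) (c 1) else 0)"
      by (simp only: sum_w [OF \<open>k < M\<close>]) simp
  qed
  also have "\<dots> = smul (of_real R * of_nat M) (c 1)"
    using M by simp
  finally have "R * real M * p (c 1) = p ?S"
    using R by (simp add: homogeneous norm_mult)
  also have "\<dots> \<le> (\<Sum>j<M. p (smul (w ^ (j * (M - 1))) (F (of_real R * w ^ j))))"
    by (rule sum_le)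
  also have "\<dots> \<le> (\<Sum>j<M. B)"
    using R by (intro sum_mono) (simp add: homogeneous norm_power norm_mult norm_w bound)
  finally have "real M * (R * p (c 1)) \<le> real M * B" by (simp add: mult_ac)
  then show ?thesis using M by simp
qed

text \<open>Replace \<open>x, y\<close> by \<open>t x, y / t\<close> and optimise over \<open>t > 0\<close>.\<close>

lemma bilinear_bound:
  assumes bound: "\<And>x y. p (B x y) \<le> (p x + p y)\<^sup>2"
    and scale: "\<And>c x y. B (smul c x) (smul (1 / c) y) = (if c = 0 then 0 else B x y)"
  shows "p (B x y) \<le> 4 * (p x * p y)"
proof -
  have *: "p (B x y) \<le> (t * p x + p y / t)\<^sup>2" if "0 < t" for t :: real
    using bound [of "smul t x" "smul (1 / t) y"] scale [of t x y] that
    by (auto simp: homogeneous norm_divide)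
  consider "0 < p x" "0 < p y" | "p x = 0" | "p y = 0"
    using nonneg [of x] nonneg [of y] by linarith
  then show ?thesis
  proof cases
    case 1
    define a b where "a = sqrt (p x)" and "b = sqrt (p y)"
    have ab: "p x = a * a" "p y = b * b" "0 < a" "0 < b"
      using 1 by (auto simp: a_def b_def)
    \<comment> \<open>The choice \<open>t = b / a\<close> makes both summands equal to
      \<open>a * b\<close>.\<close>
    have "b / a * p x + p y / (b / a) = 2 * a * b"
      using ab by (simp add: field_simps)
    then show ?thesis
      using * [of "b / a"] ab by (simp add: power2_eq_square mult_ac)
  next
    \<comment> \<open>As \<open>p x = 0\<close>, letting \<open>t\<close> grow leaves only
      \<open>p y / t\<close>, which tends to 0; the last case lets \<open>t\<close> shrink
      instead.\<close>
    case 2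
    then show ?thesis
      using * [of "real (Suc n)" for n] nonpos_if_le_inverse_square [of "p (B x y)" "p y"]
      by (simp del: of_nat_Suc)
  next
    case 3
    then show ?thesis
      using * [of "1 / real (Suc n)" for n] nonpos_if_le_inverse_square [of "p (B x y)" "p x"]
      by (simp del: of_nat_Suc)
  qed
qed

end

section \<open>Boundedness of products for uniform seminorms\<close>

locale algebra_uniform_seminorm = algebra_seminorm smul e p
  for smul :: "complex \<Rightarrow> 'a::ring \<Rightarrow> 'a" and e p +
  assumes square: "p (x * x) = (p x)\<^sup>2"
begin

text \<open>Twice the Jordan product is a difference of two squares, on which \<open>p\<close> is
  known; \<open>bilinear_bound\<close> turns the resulting quadratic bound into a product.\<close>

lemma jordan_bound: "p (x * y + y * x) \<le> 4 * (p x * p y)"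
proof (rule bilinear_bound)
  show "p (x * y + y * x) \<le> (p x + p y)\<^sup>2" for x y
  proof -
    have eq: "(x + y) * (x + y) - (x - y) * (x - y) = (x * y + y * x) + (x * y + y * x)"
      by (simp add: algebra_simps)
    have "2 * p (x * y + y * x) \<le> (p (x + y))\<^sup>2 + (p (x - y))\<^sup>2"
      unfolding double [symmetric] eq [symmetric]
      using triangle_diff [of "(x + y) * (x + y)" "(x - y) * (x - y)"] by (simp only: square)
    also have "\<dots> \<le> (p x + p y)\<^sup>2 + (p x + p y)\<^sup>2"
      by (intro add_mono power_mono triangle triangle_diff nonneg)
    finally show ?thesis by simp
  qed
qed (auto simp: smul_mult)

text \<open>\<open>2 x y x\<close> is the Jordan product of \<open>x\<close> with that of
  \<open>x\<close> and \<open>y\<close>, minus the Jordan product of \<open>x * x\<close> and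
  \<open>y\<close>, so \<open>jordan_bound\<close> gives the constant (16 + 4) / 2 = 10.\<close>

lemma triple_bound: "p (x * y * x) \<le> 10 * ((p x)\<^sup>2 * p y)"
proof -
  let ?J = "x * y + y * x"
  have eq: "x * y * x + x * y * x = (x * ?J + ?J * x) - (x * x * y + y * (x * x))"
    by (simp add: algebra_simps)
  have "2 * p (x * y * x) \<le> p (x * ?J + ?J * x) + p (x * x * y + y * (x * x))"
    unfolding double [symmetric] eq by (rule triangle_diff)
  also have "\<dots> \<le> 4 * (p x * (4 * (p x * p y))) + 4 * ((p x)\<^sup>2 * p y)"
  proof (rule add_mono)
    show "p (x * ?J + ?J * x) \<le> 4 * (p x * (4 * (p x * p y)))"
      using jordan_bound [of x ?J] mult_left_mono [OF jordan_bound [of x y] nonneg [of x]] by linarith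
    show "p (x * x * y + y * (x * x)) \<le> 4 * ((p x)\<^sup>2 * p y)"
      using jordan_bound [of "x * x" y] by (simp add: square)
  qed
  finally show ?thesis by (simp add: power2_eq_square)
qed

text \<open>The square of the commutator consists of one Jordan product and two triple products,
  with total constant 40 + 10 + 10 = 60, which is below 64 = 8 * 8.\<close>

lemma commutator_bound: "p (x * y - y * x) \<le> 8 * (p x * p y)"
proof (rule power2_le_imp_le)
  have eq: "(x * y - y * x) * (x * y - y * x) =
      (x * (y * x * y) + y * x * y * x) - x * (y * y) * x - y * (x * x) * y"
    by (simp add: algebra_simps)
  have "(p (x * y - y * x))\<^sup>2 \<le> p (x * (y * x * y) + y * x * y * x) + p (x * (y * y) * x)
      + p (y * (x * x) * y)"
    unfolding square [symmetric] eq
    using triangle_diff [of "(x * (y * x * y) + y * x * y * x) - x * (y * y) * x" "y * (x * x) * y"]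
      triangle_diff [of "x * (y * x * y) + y * x * y * x" "x * (y * y) * x"] by linarith
  also have "\<dots> \<le> 4 * (p x * (10 * ((p y)\<^sup>2 * p x))) + 10 * ((p x)\<^sup>2 * (p y)\<^sup>2) + 10 * ((p y)\<^sup>2 * (p x)\<^sup>2)"
  proof (intro add_mono)
    show "p (x * (y * x * y) + y * x * y * x) \<le> 4 * (p x * (10 * ((p y)\<^sup>2 * p x)))"
      using jordan_bound [of x "y * x * y"] mult_left_mono [OF triple_bound [of y x] nonneg [of x]]
      by linarith
  qed (use triple_bound [of x "y * y"] triple_bound [of y "x * x"] in \<open>simp_all add: square\<close>)
  also have "\<dots> = 60 * (p x * p y)\<^sup>2"
    by (simp add: power2_eq_square)
  also have "\<dots> \<le> (8 * (p x * p y))\<^sup>2"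
    by (simp add: power_mult_distrib)
  finally show "(p (x * y - y * x))\<^sup>2 \<le> (8 * (p x * p y))\<^sup>2" .
qed simp

lemma product_bound: "p (x * y) \<le> 6 * (p x * p y)"
proof -
  have "x * y + x * y = (x * y + y * x) + (x * y - y * x)" by simp
  then have "2 * p (x * y) \<le> p (x * y + y * x) + p (x * y - y * x)"
    using triangle [of "x * y + y * x" "x * y - y * x"] double [of "x * y"] by simp
  then show ?thesis
    using jordan_bound [of x y] commutator_bound [of x y] by linarith
qed

text \<open>\<open>product_bound\<close> makes the null space of \<open>p\<close> a two-sided ideal,
  so calculations may be carried out modulo null elements.\<close>

lemma null_mult: "p x = 0 \<Longrightarrow> p (x * y) = 0" "p y = 0 \<Longrightarrow> p (x * y) = 0"
  using product_bound [of x y] nonneg [of "x * y"] by (auto simp: antisym)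

lemma null_add: "p x = 0 \<Longrightarrow> p y = 0 \<Longrightarrow> p (x + y) = 0"
  using triangle [of x y] nonneg [of "x + y"] by (auto simp: antisym)

text \<open>Modulo null elements \<open>x\<close> and \<open>y\<close> commute, so
  \<open>(x y)^2\<close> may be replaced by \<open>x^2 y^2\<close>. Repeated squaring carries the
  constant 6 unchanged to the \<open>2 ^ k\<close>-th powers, where it is lost on taking
  roots.\<close>

lemma product_le_if_commuting:
  assumes "p (x * y - y * x) = 0"
  shows "p (x * y) \<le> p x * p y"
proof (rule le_if_power_le_const_mult)
  show "p (x * y) ^ (2 ^ k) \<le> 6 * (p x * p y) ^ (2 ^ k)" for k
    using assms
  proof (induction k arbitrary: x y)
    case 0
    then show ?case by (simp add: product_bound)
  next
    case (Suc k)
    let ?c = "x * y - y * x"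
    \<comment> \<open>The hypothesis passes to the squares: their commutator lies in the ideal
      generated by \<open>?c\<close>.\<close>
    have "(x * x) * (y * y) - (y * y) * (x * x) =
        x * (?c * y) + (?c * (x * y) + (y * x) * ?c) + y * (?c * x)"
      by (simp add: algebra_simps)
    then have comm: "p ((x * x) * (y * y) - (y * y) * (x * x)) = 0"
      using Suc.prems by (simp only: null_add null_mult)
    have "(x * y) * (x * y) - (x * x) * (y * y) = - (x * (?c * y))"
      by (simp add: algebra_simps)
    then have "p ((x * y) * (x * y) - (x * x) * (y * y)) = 0"
      using Suc.prems by (simp only: minus null_mult)
    then have "(p (x * y))\<^sup>2 = p ((x * x) * (y * y))"
      by (metis eq_if_diff_null square)
    then show ?case
      using Suc.IH [OF comm] by (simp add: square power_mult power_mult_distrib)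
  qed
qed simp

lemma power_two: "p (x \<up> (2 ^ k)) = p x ^ (2 ^ k)"
  by (induction k) (simp_all add: mult_2 unital.power_add square power_add power2_eq_square)

end

section \<open>Vanishing of uniform seminorms on commutators\<close>

locale normalized_uniform_seminorm = algebra_uniform_seminorm smul e p
  for smul :: "complex \<Rightarrow> 'a::ring \<Rightarrow> 'a" and e p +
  assumes unit [simp]: "p e = 1"
begin

lemma power_le: "p (x \<up> n) \<le> p x ^ n"
proof (induction n)
  case (Suc n)
  have "x * x \<up> n = x \<up> n * x" by (simp add: unital.power_commutes)
  then have "p (x * x \<up> n) \<le> p x * p (x \<up> n)"
    by (intro product_le_if_commuting) simp
  also have "\<dots> \<le> p x * p x ^ n" by (intro mult_left_mono Suc nonneg)
  finally show ?case by simp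
qed simp

text \<open>By \<open>upower_swap\<close>, the power \<open>m + 1\<close> of \<open>x * y\<close> is
  the power \<open>m\<close> of \<open>y * x\<close> between the fixed factors \<open>x\<close> and
  \<open>y\<close>, so its growth is controlled up to a constant. That constant divides by
  \<open>p (y * x)\<close>, hence the separate null case.\<close>

lemma product_commute_le: "p (x * y) \<le> p (y * x)"
proof (cases "p (y * x) = 0")
  case True
  have "(p (x * y))\<^sup>2 = p (x * ((y * x) * y))"
    by (metis mult.assoc square)
  also have "\<dots> = 0" using True by (simp only: null_mult)
  finally show ?thesis by simp
next
  case False
  then have pos: "0 < p (y * x)" using nonneg [of "y * x"] by linarith
  show ?thesis
  proof (rule le_if_power_le_const_mult)
    fix k :: nat
    obtain m where m: "2 ^ k = Suc m" by (metis not0_implies_Suc power_not_zero zero_neq_numeral)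
    have "p (x * y) ^ (2 ^ k) = p (x * ((y * x) \<up> m * y))"
      by (metis m power_two upower_swap)
    also have "\<dots> \<le> 6 * (p x * (6 * (p ((y * x) \<up> m) * p y)))"
      using product_bound [of x "(y * x) \<up> m * y"]
        mult_left_mono [OF product_bound [of "(y * x) \<up> m" y] nonneg [of x]] by linarith
    also have "\<dots> \<le> 6 * (p x * (6 * (p (y * x) ^ m * p y)))"
      by (intro mult_left_mono mult_right_mono power_le) auto
    also have "\<dots> = 36 * p x * p y / p (y * x) * p (y * x) ^ (2 ^ k)"
      using pos by (simp add: m)
    finally show "p (x * y) ^ (2 ^ k) \<le> 36 * p x * p y / p (y * x) * p (y * x) ^ (2 ^ k)" .
  qed simp
qed

lemma product_commute: "p (x * y) = p (y * x)"
  by (intro antisym product_commute_le)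

text \<open>
  With \<open>u = e + z x / n\<close> and \<open>v = e - z x / n\<close>, the polynomial \<open>u\<^sup>n y v\<^sup>n\<close> in \<open>z\<close> has linear
  coefficient \<open>x y - y x\<close>, while \<open>p (u\<^sup>n y v\<^sup>n) = p (y (v u)\<^sup>n)\<close> stays bounded for
  \<open>|z| \<le> sqrt n\<close>; Cauchy's estimate then makes the commutator null.
\<close>

lemma commutator_null: "p (x * y - y * x) = 0"
proof -
  define B where "B = 6 * (p y * exp ((p x)\<^sup>2))"
  have le: "real (Suc m) * p (x * y - y * x) \<le> B" for m
  proof -
    \<comment> \<open>A perfect square, so that the radius \<open>sqrt n\<close> of the circle is
      the integer \<open>Suc m\<close>.\<close>
    define n where "n = Suc m * Suc m"
    have n: "0 < n" by (simp add: n_def)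
    define a where "a = smul (1 / n) x"
    define F where "F k z = (e + smul z a) \<up> k * (y * (e - smul z a) \<up> k)" for k z
    have comm: "(e - smul z a) * (e + smul z a) = (e + smul z a) * (e - smul z a)" for z
      by (simp add: algebra_simps)
    \<comment> \<open>From \<open>F k\<close> to \<open>F (Suc k)\<close> there is one more left
      factor \<open>e + z a\<close> and one more right factor \<open>e - z a\<close>, each an
      instance of \<open>polynomial_affine_step\<close>. Together they add
      \<open>a * y - y * a\<close> to the linear coefficient.\<close>
    have "\<exists>c. (\<forall>j\<ge>2 * k + 1. c j = 0) \<and> c 0 = y \<and> c 1 = smul k (a * y - y * a) \<and>
        (\<forall>z. F k z = (\<Sum>j<2 * k + 1. smul (z ^ j) (c j)))" for k
    proof (induction k)
      case 0
      then show ?case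
        by (intro exI [of _ "\<lambda>j. if j = 0 then y else 0"]) (simp add: F_def)
    next
      case (Suc k)
      then obtain c where c: "\<And>j. j \<ge> 2 * k + 1 \<Longrightarrow> c j = 0" "c 0 = y" "c 1 = smul k (a * y - y * a)"
        "\<And>z. F k z = (\<Sum>j<2 * k + 1. smul (z ^ j) (c j))" by blast
      obtain c' where c': "\<And>j. j \<ge> Suc (2 * k + 1) \<Longrightarrow> c' j = 0" "c' 0 = c 0" "c' 1 = c 1 + a * c 0"
        "\<And>z. F k z + smul z (a * F k z) = (\<Sum>j<Suc (2 * k + 1). smul (z ^ j) (c' j))"
        by (rule polynomial_affine_step [OF c(1) c(4), of "\<lambda>w. a * w"])
          (auto simp: distrib_left smul_mult)
      obtain c'' where c'': "\<And>j. j \<ge> Suc (Suc (2 * k + 1)) \<Longrightarrow> c'' j = 0" "c'' 0 = c' 0"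
        "c'' 1 = c' 1 + - (c' 0 * a)"
        "\<And>z. (F k z + smul z (a * F k z)) + smul z (- ((F k z + smul z (a * F k z)) * a)) =
          (\<Sum>j<Suc (Suc (2 * k + 1)). smul (z ^ j) (c'' j))"
        by (rule polynomial_affine_step [OF c'(1) c'(4), of "\<lambda>w. - (w * a)"])
          (auto simp: distrib_right smul_mult)
      have "F (Suc k) z = (F k z + smul z (a * F k z)) + smul z (- ((F k z + smul z (a * F k z)) * a))" for z
      proof -
        have "(e - smul z a) \<up> Suc k = (e - smul z a) \<up> k * (e - smul z a)"
          by (simp add: unital.power_commutes)
        then have "F (Suc k) z = (e + smul z a) * F k z * (e - smul z a)"
          by (simp add: F_def mult.assoc)
        then show ?thesis
          by (simp add: distrib_left distrib_right left_diff_distrib right_diff_distrib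
              smul_mult scale_right_distrib scale_right_diff_distrib)
      qed
      then have "\<forall>z. F (Suc k) z = (\<Sum>j<2 * Suc k + 1. smul (z ^ j) (c'' j))"
        using c''(4) by simp
      moreover have "c'' 1 = smul (Suc k) (a * y - y * a)"
        by (simp only: c''(3) c'(2,3) c(2,3) of_nat_Suc scale_left_distrib scale_one) simp
      moreover have "\<forall>j\<ge>2 * Suc k + 1. c'' j = 0" "c'' 0 = y"
        using c''(1) by (auto simp: c''(2) c'(2) c(2))
      ultimately show ?case by blast
    qed
    then obtain c where c: "c 1 = smul n (a * y - y * a)"
        "\<And>z. F n z = (\<Sum>j<2 * n + 1. smul (z ^ j) (c j))" by blast
    have c1: "c 1 = x * y - y * x"
      unfolding c(1) using n by (simp add: a_def smul_mult scale_right_diff_distrib)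
    have "real (Suc m) * p (c 1) \<le> B"
    proof (rule coefficient_bound [where F = "F n" and M = "2 * n + 1"])
      show "F n z = (\<Sum>j<2 * n + 1. smul (z ^ j) (c j))" for z by (rule c(2))
      fix z assume z: "cmod z = real (Suc m)"
      \<comment> \<open>The terms linear in \<open>z\<close> cancel. On the circle
        \<open>|z|^2 = n\<close>, so the product differs from \<open>e\<close> by at most
        \<open>(p x)^2 / n\<close>, and its \<open>n\<close>-th power stays below an
        exponential.\<close>
      have "(e - smul z a) * (e + smul z a) = e - smul ((z / n) * (z / n)) (x * x)"
        by (simp add: algebra_simps a_def smul_mult)
      then have "p ((e - smul z a) * (e + smul z a)) \<le> 1 + cmod ((z / n) * (z / n)) * (p x)\<^sup>2"
        using triangle_diff [of e "smul ((z / n) * (z / n)) (x * x)"] by (simp add: homogeneous square)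
      also have "cmod ((z / n) * (z / n)) = 1 / real n"
        unfolding norm_mult norm_divide z norm_of_nat n_def of_nat_mult by simp
      finally have "p ((e - smul z a) * (e + smul z a)) ^ n \<le> (1 + (p x)\<^sup>2 / real n) ^ n"
        by (intro power_mono) auto
      also have "\<dots> \<le> exp ((p x)\<^sup>2)"
        by (rule exp_ge_one_plus_x_over_n_power_n) (use n zero_le_power2 [of "p x"] in linarith)+
      finally have vu: "p (((e - smul z a) * (e + smul z a)) \<up> n) \<le> exp ((p x)\<^sup>2)"
        using power_le order_trans by blast
      \<comment> \<open>\<open>product_commute\<close> moves the left power to the far right, next
        to the other one, where \<open>comm\<close> merges them.\<close>
      have "p (F n z) = p (y * ((e - smul z a) * (e + smul z a)) \<up> n)"
        unfolding F_def product_commute [of "(e + smul z a) \<up> n"] upower_mult_commuting [OF comm]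
        by (simp only: mult.assoc)
      also have "\<dots> \<le> 6 * (p y * p (((e - smul z a) * (e + smul z a)) \<up> n))"
        by (rule product_bound)
      also have "\<dots> \<le> B"
        unfolding B_def by (intro mult_left_mono vu) auto
      finally show "p (F n z) \<le> B" .
    qed (use n in auto)
    then show ?thesis by (simp only: c1)
  qed
  show ?thesis
  proof (rule ccontr)
    assume "p (x * y - y * x) \<noteq> 0"
    then have pos: "0 < p (x * y - y * x)"
      using nonneg [of "x * y - y * x"] by linarith
    obtain m where "B < real m * p (x * y - y * x)"
      using ex_less_of_nat_mult [OF pos] by blast
    moreover have "real m * p (x * y - y * x) \<le> real (Suc m) * p (x * y - y * x)"
      by (intro mult_right_mono) auto
    ultimately show False using le [of m] by linarith
  qed
qed

lemma submultiplicative: "p (x * y) \<le> p x * p y"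
  by (rule product_le_if_commuting [OF commutator_null])

end

section \<open>Infima of chains of seminorms\<close>

lemma (in unital_complex_algebra) normalized_uniform_seminormI:
  assumes "seminorm smul q" "\<And>y w. q (y * w) \<le> q y * q w" "\<And>y. (q y)\<^sup>2 \<le> q (y * y)" "q e = 1"
  shows "normalized_uniform_seminorm smul e q"
proof unfold_locales
  show "q (y * y) = (q y)\<^sup>2" for y
    using assms(2) [of y y] assms(3) [of y] by (simp add: power2_eq_square)
qed (use assms in auto)

lemma le_mult_INF:
  fixes g :: "'b \<Rightarrow> real"
  assumes "C \<noteq> {}" "\<And>q. q \<in> C \<Longrightarrow> 0 \<le> g q" "0 \<le> a" "\<And>q. q \<in> C \<Longrightarrow> c \<le> a * g q"
  shows "c \<le> a * (INF q\<in>C. g q)"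
proof (cases "a = 0")
  case True
  then show ?thesis using assms(1,4) by auto
next
  case False
  with assms have "c / a \<le> (INF q\<in>C. g q)"
    by (intro cINF_greatest) (auto simp: field_simps)
  then show ?thesis using False assms(3) by (simp add: field_simps)
qed

text \<open>Comparability lets two members of \<open>C\<close> be replaced by the smaller one, so
  the infima in \<open>y\<close> and \<open>w\<close> may be taken independently. The hypothesis on
  products allows another member \<open>q'\<close> on the left, because in the smoothing sequence
  the bound for index \<open>k\<close> is obtained at index \<open>Suc k\<close>.\<close>

lemma (in unital_complex_algebra) chain_infimum:
  assumes C: "C \<noteq> {}" "\<And>q q'. q \<in> C \<Longrightarrow> q' \<in> C \<Longrightarrow> q \<le> q' \<or> q' \<le> q"
    and seminorm: "\<And>q. q \<in> C \<Longrightarrow> seminorm smul q"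
    and product: "\<And>q. q \<in> C \<Longrightarrow> \<exists>q'\<in>C. \<forall>y w. q' (y * w) \<le> q y * q w"
    and square: "\<And>q y. q \<in> C \<Longrightarrow> (q y)\<^sup>2 \<le> q (y * y)"
    and unit: "\<And>q. q \<in> C \<Longrightarrow> q e = 1"
  shows "normalized_uniform_seminorm smul e (\<lambda>y. INF q\<in>C. q y)"
proof (rule normalized_uniform_seminormI)
  let ?I = "\<lambda>y. INF q\<in>C. q y"
  have nonneg: "0 \<le> q y" and triangle: "q (y + w) \<le> q y + q w"
    and homogeneous: "q (smul c y) = cmod c * q y" if "q \<in> C" for q y w c
    using seminorm [OF that] by (auto simp: seminorm_def)
  have lower: "?I y \<le> q y" if "q \<in> C" for q y
    by (rule cINF_lower) (use that nonneg in \<open>auto intro: bdd_belowI [of _ 0]\<close>)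
  have I_nonneg: "0 \<le> ?I y" for y
    by (rule cINF_greatest) (use C nonneg in auto)
  show "seminorm smul ?I"
    unfolding seminorm_def
  proof (intro conjI allI)
    show "?I (y + w) \<le> ?I y + ?I w" for y w
    proof -
      have *: "?I (y + w) \<le> q y + q' w" if "q \<in> C" "q' \<in> C" for q q'
      proof -
        obtain r where r: "r \<in> C" "r \<le> q" "r \<le> q'"
          using C(2) [OF \<open>q \<in> C\<close> \<open>q' \<in> C\<close>] \<open>q \<in> C\<close> \<open>q' \<in> C\<close> by blast
        have "?I (y + w) \<le> r y + r w"
          using lower triangle r(1) order_trans by blast
        also have "\<dots> \<le> q y + q' w"
          using r by (intro add_mono) (auto simp: le_fun_def)
        finally show ?thesis .
      qed
      have "?I (y + w) - q y \<le> ?I w" if "q \<in> C" for q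
        by (rule cINF_greatest [OF C(1)]) (use * [OF that] in \<open>simp add: diff_le_eq add.commute\<close>)
      then have "?I (y + w) - ?I w \<le> ?I y"
        by (intro cINF_greatest [OF C(1)]) (simp add: diff_le_eq add.commute)
      then show ?thesis by simp
    qed
    show "?I (smul c y) = cmod c * ?I y" for c y
    proof (rule antisym)
      show "?I (smul c y) \<le> cmod c * ?I y"
        by (rule le_mult_INF [OF C(1)]) (use lower homogeneous nonneg norm_ge_zero in metis)+
      show "cmod c * ?I y \<le> ?I (smul c y)"
        by (rule cINF_greatest [OF C(1)]) (simp add: homogeneous lower mult_left_mono)
    qed
  qed (rule I_nonneg)
  show "?I (y * w) \<le> ?I y * ?I w" for y w
  proof -
    have *: "?I (y * w) \<le> q y * q' w" if "q \<in> C" "q' \<in> C" for q q'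
    proof -
      obtain r where r: "r \<in> C" "r \<le> q" "r \<le> q'"
        using C(2) [OF \<open>q \<in> C\<close> \<open>q' \<in> C\<close>] \<open>q \<in> C\<close> \<open>q' \<in> C\<close> by blast
      obtain s where s: "s \<in> C" "\<And>y w. s (y * w) \<le> r y * r w"
        using product r(1) by blast
      have "?I (y * w) \<le> r y * r w"
        using lower s order_trans by blast
      also have "\<dots> \<le> q y * q' w"
        using r that by (intro mult_mono nonneg) (auto simp: le_fun_def)
      finally show ?thesis .
    qed
    have "?I (y * w) \<le> q y * ?I w" if "q \<in> C" for q
      by (rule le_mult_INF [OF C(1)]) (use * that nonneg in auto)
    then have "?I (y * w) \<le> ?I w * ?I y"
      by (intro le_mult_INF [OF C(1)]) (use I_nonneg nonneg in \<open>auto simp: mult.commute\<close>)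
    then show ?thesis by (simp add: mult.commute)
  qed
  show "(?I y)\<^sup>2 \<le> ?I (y * y)" for y
  proof (rule cINF_greatest [OF C(1)])
    fix q assume q: "q \<in> C"
    then have "(?I y)\<^sup>2 \<le> (q y)\<^sup>2"
      by (intro power_mono lower I_nonneg)
    then show "(?I y)\<^sup>2 \<le> q (y * y)"
      using square [OF q, of y] by linarith
  qed
  show "?I e = 1"
    using C(1) by (simp add: unit)
qed

section \<open>Smoothing along the powers of an element\<close>

text \<open>The seminorm obtained is \<open>y \<mapsto> lim p (y z\<^sup>n) / p (z)\<^sup>n\<close>, along \<open>n = 2\<^sup>k\<close>.\<close>

lemma (in normalized_uniform_seminorm) smoothing:
  assumes z: "p z \<noteq> 0"
  obtains q where "normalized_uniform_seminorm smul e q" "\<And>y. q y \<le> p y"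
    "\<And>y. q y * p z \<le> p (y * z)"
    "\<And>x. (\<And>y. p y \<le> p (x * y)) \<Longrightarrow> (\<And>y. q y \<le> q (x * y))"
    "p z = 1 \<Longrightarrow> (\<And>y. q y \<le> q (z * y))"
proof
  define a where "a k y = p (y * z \<up> (2 ^ k)) / p z ^ (2 ^ k)" for k :: nat and y
  have pos: "0 < p z" using z nonneg [of z] by linarith
  have two: "z \<up> (2 ^ Suc k) = z \<up> (2 ^ k) * z \<up> (2 ^ k)" for k
    by (simp add: mult_2 unital.power_add)
  \<comment> \<open>Commutators are null, so a power of \<open>z\<close> may be moved past
    \<open>w\<close>.\<close>
  have swap: "p (y * w * (z \<up> n * z \<up> n)) = p (y * z \<up> n * (w * z \<up> n))" for y w n
  proof -
    have "y * w * (z \<up> n * z \<up> n) - y * z \<up> n * (w * z \<up> n) =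
        y * ((w * z \<up> n - z \<up> n * w) * z \<up> n)"
      by (simp add: algebra_simps)
    then have "p (y * w * (z \<up> n * z \<up> n) - y * z \<up> n * (w * z \<up> n)) = 0"
      by (simp only: null_mult commutator_null)
    then show ?thesis by (rule eq_if_diff_null)
  qed
  have a_seminorm: "seminorm smul (a k)" for k
    unfolding seminorm_def a_def
    using pos by (auto simp: smul_mult homogeneous divide_right_mono distrib_right triangle simp flip: add_divide_distrib)
  then have a_nonneg: "0 \<le> a k y" for k y by (simp add: seminorm_def)
  have a_le: "a k y \<le> p y" for k y
    using submultiplicative [of y "z \<up> (2 ^ k)"] pos by (simp add: a_def power_two field_simps)
  have a_unit: "a k e = 1" for k
    using pos by (simp add: a_def power_two)
  have denom: "p z ^ 2 ^ Suc k = p z ^ 2 ^ k * p z ^ 2 ^ k" for k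
    by (simp add: mult_2 power_add)
  have a_Suc: "a (Suc k) \<le> a k" for k
  proof (rule le_funI)
    fix y
    have "p (y * z \<up> (2 ^ k) * z \<up> (2 ^ k)) \<le> p (y * z \<up> (2 ^ k)) * p z ^ 2 ^ k"
      using submultiplicative [of "y * z \<up> (2 ^ k)" "z \<up> (2 ^ k)"] by (simp only: power_two)
    then show "a (Suc k) y \<le> a k y"
      unfolding a_def two denom mult.assoc [symmetric] using pos by (simp add: field_simps)
  qed
  \<comment> \<open>The exponent \<open>2 ^ Suc k\<close> provides a full power \<open>2 ^ k\<close>
    of \<open>z\<close> for each of \<open>y\<close> and \<open>w\<close>; the same splitting lets
    \<open>a_square\<close> start from an equality.\<close>
  have a_product: "a (Suc k) (y * w) \<le> a k y * a k w" for k y w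
    using submultiplicative [of "y * z \<up> (2 ^ k)" "w * z \<up> (2 ^ k)"] pos
    unfolding a_def two denom swap by (simp add: divide_right_mono)
  have a_square: "(a k y)\<^sup>2 \<le> a k (y * y)" for k y
  proof -
    have "(a k y)\<^sup>2 = a (Suc k) (y * y)"
      unfolding a_def two denom swap square by (simp add: power2_eq_square)
    then show ?thesis using a_Suc [of k] by (simp add: le_fun_def)
  qed
  have anti: "a j \<le> a i" if "i \<le> j" for i j
    using that by (rule lift_Suc_antimono_le [of a, OF a_Suc])
  define q where "q y = (INF f\<in>range a. f y)" for y
  have lower: "q y \<le> a k y" for k y
    unfolding q_def
    by (rule cINF_lower) (use a_nonneg in \<open>auto intro: bdd_belowI [of _ 0]\<close>)
  show "normalized_uniform_seminorm smul e q"
    unfolding q_def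
  proof (rule chain_infimum)
    show "f \<le> f' \<or> f' \<le> f" if "f \<in> range a" "f' \<in> range a" for f f'
      using that anti nat_le_linear by blast
    show "\<exists>f'\<in>range a. \<forall>y w. f' (y * w) \<le> f y * f w" if "f \<in> range a" for f
      using that a_product by blast
  qed (auto simp: a_seminorm a_square a_unit)
  show "q y \<le> p y" for y
    using lower [of y 0] a_le [of 0 y] by linarith
  \<comment> \<open>At index 0 the exponent is \<open>2 ^ 0 = 1\<close>, so \<open>a 0 y\<close> is
    \<open>p (y * z) / p z\<close>.\<close>
  show "q y * p z \<le> p (y * z)" for y
    using lower [of y 0] pos by (simp add: a_def field_simps)
  show "q y \<le> q (x * y)" if "\<And>y. p y \<le> p (x * y)" for x y
  proof -
    have "q y \<le> a k (x * y)" for k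
      using that [of "y * z \<up> (2 ^ k)"] lower [of y k] pos
      by (simp add: a_def mult.assoc divide_right_mono order_trans)
    then show ?thesis
      unfolding q_def [of "x * y"] by (auto intro: cINF_greatest)
  qed
  show "q y \<le> q (z * y)" if z1: "p z = 1" for y
  proof -
    have "q y \<le> a k (z * y)" for k
    proof -
      \<comment> \<open>One factor \<open>z\<close> is moved in front of \<open>y\<close>; the
        remaining \<open>m\<close> factors of that half are dropped, since \<open>p z = 1\<close>
        bounds their seminorm by 1.\<close>
      obtain m where m: "2 ^ k = Suc m" by (metis not0_implies_Suc power_not_zero zero_neq_numeral)
      have "(y * z - z * y) * (z \<up> m * z \<up> (2 ^ k)) = y * z \<up> (2 ^ Suc k) - z * y * (z \<up> m * z \<up> (2 ^ k))"
        unfolding two by (simp add: m algebra_simps)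
      then have "p (y * z \<up> (2 ^ Suc k)) = p (z * y * (z \<up> m * z \<up> (2 ^ k)))"
        by (metis eq_if_diff_null null_mult(1) commutator_null)
      also have "\<dots> = p (z * y * z \<up> (2 ^ k) * z \<up> m)"
        by (metis add.commute mult.assoc unital.power_add)
      also have "\<dots> \<le> p (z * y * z \<up> (2 ^ k)) * p (z \<up> m)"
        by (rule submultiplicative)
      also have "\<dots> \<le> p (z * y * z \<up> (2 ^ k)) * 1"
        using power_le [of z m] by (intro mult_left_mono) (auto simp: z1)
      finally have "a (Suc k) y \<le> a k (z * y)"
        by (simp add: a_def z1)
      then show ?thesis using lower [of y "Suc k"] by linarith
    qed
    then show ?thesis
      unfolding q_def [of "z * y"] by (auto intro: cINF_greatest)
  qed
qed

section \<open>Gelfand--Mazur for multiplicative seminorms\<close>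

locale multiplicative_seminorm = algebra_seminorm smul e p
  for smul :: "complex \<Rightarrow> 'a::ring \<Rightarrow> 'a" and e p +
  assumes multiplicative: "p (x * y) = p x * p y"
    and unit [simp]: "p e = 1"
begin

text \<open>
  The elementary proof of the Gelfand--Mazur theorem: \<open>u\<^sup>2 - s\<^sup>2 e = (u - s e) (u + s e)\<close>, so the
  distance from \<open>u\<close> to the scalars is squared when \<open>u\<close> is squared.
\<close>

lemma factor_difference: "u * u - smul (s * s) e = (u - smul s e) * (u + smul s e)"
  by (simp add: algebra_simps smul_mult)

lemma distance_square:
  assumes "\<And>c. m \<le> p (u - smul c e)" "0 \<le> m"
  shows "m\<^sup>2 \<le> p (u * u - smul c e)"
proof -
  have c: "csqrt c * csqrt c = c"
    by (metis power2_csqrt power2_eq_square)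
  have "m * m \<le> p (u - smul (csqrt c) e) * p (u - smul (- csqrt c) e)"
    using assms(1) [of "csqrt c"] assms(1) [of "- csqrt c"] assms(2) by (intro mult_mono) auto
  also have "\<dots> = p (u * u - smul c e)"
    using factor_difference [of u "csqrt c"] c by (simp add: multiplicative)
  finally show ?thesis by (simp add: power2_eq_square)
qed

text \<open>In the factorisation of \<open>u^2 - c^2 e\<close> the factor \<open>u + c e\<close> has
  seminorm at least \<open>m\<close>, so \<open>p (u - c e)\<close> is at most
  \<open>p (u^2 - c^2 e) / m\<close>. The square \<open>u * u\<close> satisfies the same hypotheses
  with \<open>m^2\<close>, and the estimate can be iterated.\<close>

lemma distance_le:
  assumes "p u = m" "0 < m" "\<And>c. m \<le> p (u - smul c e)"
  shows "p (u - smul c e) \<le> m * (1 + (cmod c / m) ^ (2 ^ k))"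
  using assms
proof (induction k arbitrary: u m c)
  case 0
  then show ?case
    using triangle_diff [of u "smul c e"] by (simp add: homogeneous distrib_left)
next
  case (Suc k)
  have "p (u * u - smul (c * c) e) \<le> m\<^sup>2 * (1 + (cmod (c * c) / m\<^sup>2) ^ (2 ^ k))"
  proof (rule Suc.IH)
    show "m\<^sup>2 \<le> p (u * u - smul b e)" for b
      by (rule distance_square) (use Suc.prems in auto)
  qed (use Suc.prems in \<open>auto simp: multiplicative power2_eq_square\<close>)
  moreover have "p (u - smul c e) * m \<le> p (u * u - smul (c * c) e)"
    unfolding factor_difference multiplicative
    using Suc.prems(3) [of "- c"] by (intro mult_left_mono) auto
  ultimately have "p (u - smul c e) * m \<le> m * (1 + (cmod c / m) ^ (2 ^ Suc k)) * m"
    by (simp add: power2_eq_square norm_mult power_mult power_mult_distrib power_divide mult_ac)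
  then show ?case using Suc.prems(2) by (simp only: mult_le_cancel_right_pos)
qed

lemma distance_eq:
  assumes u: "p u = m" "0 < m" "\<And>c. m \<le> p (u - smul c e)" and c: "cmod c < m"
  shows "p (u - smul c e) = m"
proof (rule antisym)
  have "(\<lambda>n. (cmod c / m) ^ n) \<longlonglongrightarrow> 0"
    using u c by (intro LIMSEQ_realpow_zero) auto
  then have "((\<lambda>n. (cmod c / m) ^ n) \<circ> (\<lambda>k. 2 ^ k)) \<longlonglongrightarrow> 0"
    by (rule LIMSEQ_subseq_LIMSEQ) (simp add: strict_mono_def)
  then have "(\<lambda>k. m * (1 + (cmod c / m) ^ (2 ^ k))) \<longlonglongrightarrow> m * (1 + 0)"
    unfolding comp_def by (intro tendsto_mult_left tendsto_add tendsto_const)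
  then have "p (u - smul c e) \<le> m * (1 + 0)"
    by (rule LIMSEQ_le_const) (use distance_le [OF u] in blast)
  then show "p (u - smul c e) \<le> m" by simp
qed (rule u)

text \<open>The distance from \<open>y\<close> to the scalars attains its minimum by compactness.
  Were it positive, \<open>distance_eq\<close> would preserve it along steps of half its size,
  contradicting the growth of the distance at infinity.\<close>

lemma ex_null_translate: "\<exists>c. p (y - smul c e) = 0"
proof -
  define h where "h c = p (y - smul c e)" for c
  have lip: "\<bar>h b - h c\<bar> \<le> cmod (b - c)" for b c
  proof -
    have "h b \<le> h c + cmod (b - c)" for b c
    proof -
      have "h b \<le> p (y - smul c e) + p (smul (c - b) e)"
        unfolding h_def using triangle [of "y - smul c e" "smul (c - b) e"]
        by (simp add: scale_left_diff_distrib)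
      then show ?thesis by (simp add: h_def homogeneous norm_minus_commute)
    qed
    from this [of b c] this [of c b] show ?thesis
      by (simp add: norm_minus_commute abs_le_iff)
  qed
  have "continuous_on UNIV h"
    unfolding continuous_on_iff dist_norm real_norm_def using lip by (meson le_less_trans)
  \<comment> \<open>Outside the radius \<open>2 * p y\<close> the distance exceeds
    \<open>p y = h 0\<close>, so a minimum on the disc is a global one.\<close>
  then have "\<exists>c\<in>cball 0 (2 * p y). \<forall>b\<in>cball 0 (2 * p y). h c \<le> h b"
    by (intro continuous_attains_inf) (auto intro: continuous_on_subset simp: not_less)
  then obtain c where c: "\<And>b. cmod b \<le> 2 * p y \<Longrightarrow> h c \<le> h b"
    unfolding mem_cball_0 Ball_def by blast
  have growth: "cmod b - p y \<le> h b" for b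
    unfolding h_def using triangle_diff [of y "y - smul b e"] by (simp add: homogeneous)
  have min: "h c \<le> h b" for b
  proof (cases "cmod b \<le> 2 * p y")
    case False
    have "h c \<le> h 0" by (rule c) simp
    then show ?thesis using growth [of b] False by (simp add: h_def)
  qed (rule c)
  have "h c = 0"
  proof (rule ccontr)
    assume "h c \<noteq> 0"
    then have m: "0 < h c" using nonneg [of "y - smul c e"] by (simp add: h_def less_le)
    have "h (c + of_nat n * of_real (h c / 2)) = h c" for n
    proof (induction n)
      case (Suc n)
      let ?b = "c + of_nat n * of_real (h c / 2)"
      have "p (y - smul ?b e - smul (of_real (h c / 2)) e) = h c"
      proof (rule distance_eq)
        show "p (y - smul ?b e) = h c" using Suc by (simp add: h_def)
        show "h c \<le> p (y - smul ?b e - smul a e)" for a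
          using min [of "?b + a"] by (simp add: h_def scale_left_distrib diff_diff_eq)
        show "cmod (of_real (h c / 2)) < h c" using m unfolding norm_of_real by simp
      qed (rule m)
      moreover have "c + of_nat (Suc n) * of_real (h c / 2) = ?b + of_real (h c / 2)"
        by (simp add: algebra_simps)
      ultimately show ?case
        by (simp only: h_def scale_left_distrib diff_diff_eq)
    qed simp
    moreover obtain n where n: "h c + p y + cmod c < real n * (h c / 2)"
      using ex_less_of_nat_mult [of "h c / 2"] m half_gt_zero by blast
    moreover have "real n * (h c / 2) \<le> cmod (c + of_nat n * of_real (h c / 2)) + cmod c"
      using norm_triangle_ineq4 [of "c + of_nat n * of_real (h c / 2)" c] m
      by (simp add: norm_mult)
    ultimately show False
      using growth [of "c + of_nat n * of_real (h c / 2)"] by simp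
  qed
  then show ?thesis by (auto simp: h_def)
qed

text \<open>By \<open>ex_null_translate\<close> every element is a scalar modulo null elements, and
  \<open>p e = 1\<close> makes that scalar unique. The algebraic properties of \<open>f\<close>
  follow by checking that the proposed scalar leaves a null remainder.\<close>

lemma ex_character:
  obtains f where "Vector_Spaces.linear smul (*) f" "\<And>x y. f (x * y) = f x * f y" "f e = 1"
    "\<And>y. cmod (f y) = p y"
proof -
  define f where "f y = (SOME c. p (y - smul c e) = 0)" for y
  have f: "p (y - smul (f y) e) = 0" for y
    unfolding f_def by (rule someI_ex) (rule ex_null_translate)
  have f_eq: "f y = c" if "p (y - smul c e) = 0" for y c
  proof -
    have "smul (c - f y) e = (y - smul (f y) e) - (y - smul c e)"
      by (simp add: scale_left_diff_distrib)
    then have "cmod (c - f y) \<le> 0"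
      using triangle_diff [of "y - smul (f y) e" "y - smul c e"] f [of y] that homogeneous [of "c - f y" e]
      by simp
    then show ?thesis by simp
  qed
  have null_add: "p (u + v) = 0" if "p u = 0" "p v = 0" for u v
    using triangle [of u v] nonneg [of "u + v"] that by simp
  show thesis
  proof
    show "f (x * y) = f x * f y" for x y
    proof (rule f_eq)
      have "x * y - smul (f x * f y) e = (x - smul (f x) e) * y + smul (f x) (y - smul (f y) e)"
        by (simp add: algebra_simps smul_mult)
      then show "p (x * y - smul (f x * f y) e) = 0"
        by (simp add: null_add multiplicative homogeneous f)
    qed
    show "f e = 1" by (rule f_eq) simp
    show "cmod (f y) = p y" for y
      using eq_if_diff_null [OF f [of y]] by (simp add: homogeneous)
    have "f (x + y) = f x + f y" for x y
    proof (rule f_eq)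
      have "x + y - smul (f x + f y) e = (x - smul (f x) e) + (y - smul (f y) e)"
        by (simp add: scale_left_distrib)
      then show "p (x + y - smul (f x + f y) e) = 0" by (simp only: null_add f)
    qed
    moreover have "f (smul c x) = c * f x" for c x
    proof (rule f_eq)
      have "smul c x - smul (c * f x) e = smul c (x - smul (f x) e)"
        by (simp add: scale_right_diff_distrib)
      then show "p (smul c x - smul (c * f x) e) = 0" by (simp add: homogeneous f)
    qed
    moreover have "vector_space ((*) :: complex \<Rightarrow> complex \<Rightarrow> complex)"
      by unfold_locales (auto simp: algebra_simps)
    ultimately show "Vector_Spaces.linear smul (*) f"
      unfolding Vector_Spaces.linear_iff using vector_space_axioms by blast
  qed
qed

end

section \<open>A minimal seminorm norming an element\<close>

lemma (in normalized_uniform_seminorm) ex_norming_multiplicative_seminorm: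
  assumes x: "p x = 1"
  obtains q where "multiplicative_seminorm smul e q" "\<And>y. q y \<le> p y" "q x = 1"
proof -
  \<comment> \<open>The last condition, taken at \<open>e\<close>, gives \<open>1 \<le> q x\<close>;
    stated for all \<open>y\<close>, it is inherited by infima of chains and by smoothing.\<close>
  define Q where "Q = {q. normalized_uniform_seminorm smul e q \<and> q \<le> p \<and> (\<forall>y. q y \<le> q (x * y))}"
  have "p x \<noteq> 0" using x by simp
  then obtain q0 where q0: "q0 \<in> Q"
  proof (rule smoothing)
    fix q assume "normalized_uniform_seminorm smul e q" "\<And>y. q y \<le> p y"
      "p x = 1 \<Longrightarrow> (\<And>y. q y \<le> q (x * y))"
    then show thesis
      using x that [of q] by (simp add: Q_def le_fun_def)
  qed
  \<comment> \<open>Zorn's lemma is applied to the reversed order, so its maximal element is a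
    minimal seminorm.\<close>
  have "\<exists>m\<in>Q. \<forall>q\<in>Q. q \<le> m \<longrightarrow> q = m"
  proof (rule predicate_Zorn)
    show "partial_order_on Q (relation_of (\<lambda>a b. b \<le> a) Q)"
      by (rule partial_order_on_relation_ofI) auto
    fix C assume C: "C \<in> Chains (relation_of (\<lambda>a b. b \<le> a) Q)"
    then have CQ: "C \<subseteq> Q" and chain: "\<And>q q'. q \<in> C \<Longrightarrow> q' \<in> C \<Longrightarrow> q \<le> q' \<or> q' \<le> q"
      by (auto simp: Chains_def relation_of_def)
    show "\<exists>q\<in>Q. \<forall>q'\<in>C. q \<le> q'"
    proof (cases "C = {}")
      case True
      then show ?thesis using q0 by blast
    next
      case False
      have C_norm: "normalized_uniform_seminorm smul e q" if "q \<in> C" for q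
        using that CQ by (auto simp: Q_def)
      have C_nonneg: "0 \<le> q y" if "q \<in> C" for q y
      proof -
        interpret q: normalized_uniform_seminorm smul e q by (rule C_norm [OF that])
        show ?thesis by (rule q.nonneg)
      qed
      let ?I = "\<lambda>y. INF q\<in>C. q y"
      have lower: "?I y \<le> q y" if "q \<in> C" for q y
        by (rule cINF_lower) (use that C_nonneg in \<open>auto intro: bdd_belowI [of _ 0]\<close>)
      have "normalized_uniform_seminorm smul e ?I"
      proof (rule chain_infimum [OF False chain])
        fix q assume "q \<in> C"
        then interpret q: normalized_uniform_seminorm smul e q by (rule C_norm)
        show "seminorm smul q" by (rule q.seminorm)
        show "(q y)\<^sup>2 \<le> q (y * y)" for y by (simp add: q.square)
        show "\<exists>q'\<in>C. \<forall>y w. q' (y * w) \<le> q y * q w"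
          using \<open>q \<in> C\<close> q.submultiplicative by blast
        show "q e = 1" by (rule q.unit)
      qed
      moreover obtain q where "q \<in> C" using False by blast
      then have "?I \<le> q" "q \<le> p"
        using lower CQ by (auto simp: Q_def le_fun_def)
      then have "?I \<le> p" by (rule order_trans)
      moreover have "?I y \<le> ?I (x * y)" for y
      proof (rule cINF_greatest [OF False])
        fix q assume q: "q \<in> C"
        then have "q y \<le> q (x * y)" using CQ by (auto simp: Q_def)
        then show "?I y \<le> q (x * y)" using lower [OF q, of y] by linarith
      qed
      ultimately have "?I \<in> Q" by (simp add: Q_def)
      then show ?thesis
        by (rule rev_bexI) (simp add: le_fun_def lower)
    qed
  qed
  then obtain m where m: "m \<in> Q" and minimal: "\<And>q. q \<in> Q \<Longrightarrow> q \<le> m \<Longrightarrow> q = m" by blast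
  interpret m: normalized_uniform_seminorm smul e m using m by (simp add: Q_def)
  \<comment> \<open>Smoothing \<open>m\<close> along \<open>z\<close> stays in \<open>Q\<close> and
    below \<open>m\<close>, so by minimality it changes nothing; the estimate
    \<open>q y * m z \<le> m (y * z)\<close> then holds with \<open>q = m\<close>.\<close>
  have "m y * m z \<le> m (y * z)" for y z
  proof (cases "m z = 0")
    case False
    show ?thesis
    proof (rule m.smoothing [OF False])
      fix q
      assume q: "normalized_uniform_seminorm smul e q" "\<And>y. q y \<le> m y"
        "\<And>y. q y * m z \<le> m (y * z)" "\<And>x y. (\<And>y. m y \<le> m (x * y)) \<Longrightarrow> q y \<le> q (x * y)"
      have "q \<in> Q"
      proof -
        have "q y \<le> p y" for y
        proof -
          have "m y \<le> p y" using m by (simp add: Q_def le_fun_def)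
          then show ?thesis using q(2) [of y] by linarith
        qed
        moreover have "\<forall>y. m y \<le> m (x * y)" using m by (simp add: Q_def)
        ultimately show ?thesis using q(1,4) by (simp add: Q_def le_fun_def)
      qed
      then have "q = m" using minimal q(2) by (simp add: le_fun_def)
      then show ?thesis using q(3) by simp
    qed
  qed simp
  then have mult: "m (y * z) = m y * m z" for y z
    by (intro antisym m.submultiplicative)
  show thesis
  proof
    show "multiplicative_seminorm smul e m"
      by unfold_locales (simp_all add: mult)
    show "m y \<le> p y" for y using m by (simp add: Q_def le_fun_def)
    have "m e \<le> m (x * e)" using m unfolding Q_def by blast
    moreover have "m x \<le> p x" using m by (simp add: Q_def le_fun_def)
    ultimately show "m x = 1" using x by simp
  qed
qed

section \<open>Topologies defined by seminorms\<close>

lemma openin_seminorm_ball: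
  assumes "p \<in> P" "0 < r"
  shows "openin (seminorm_topology P) {y. p (y - x) < r}"
  unfolding seminorm_topology_def openin_topology_generated_by_iff
  by (rule generate_topology_on.Basis) (use assms in blast)

lemma (in algebra_seminorm) continuous_map_if_le_seminorm:
  assumes f: "Vector_Spaces.linear smul (*) f" "\<And>x. cmod (f x) \<le> p x" and p: "p \<in> P"
  shows "continuous_map (seminorm_topology P) euclidean f"
proof -
  interpret f: Vector_Spaces.linear smul "(*)" f by (rule f)
  have top: "topspace (seminorm_topology P) = UNIV"
    unfolding seminorm_topology_def topology_generated_by_topspace by auto
  have "openin (seminorm_topology P) {x. f x \<in> U}" if U: "open U" for U
  proof (subst openin_subopen, intro ballI)
    fix x assume "x \<in> {x. f x \<in> U}"
    then obtain r where r: "0 < r" "ball (f x) r \<subseteq> U"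
      using U by (auto simp: open_contains_ball)
    have "{y. p (y - x) < r} \<subseteq> {x. f x \<in> U}"
    proof
      fix y assume "y \<in> {y. p (y - x) < r}"
      then have "cmod (f y - f x) < r"
        using f(2) [of "y - x"] by (simp add: f.diff)
      then show "y \<in> {x. f x \<in> U}"
        using r by (auto simp: dist_norm norm_minus_commute)
    qed
    then show "\<exists>V. openin (seminorm_topology P) V \<and> x \<in> V \<and> V \<subseteq> {x. f x \<in> U}"
      using openin_seminorm_ball [OF p r(1), of x] r(1) by auto
  qed
  then show ?thesis by (simp add: continuous_map_def top)
qed

text \<open>Every ball of the zero seminorm is \<open>UNIV\<close>, which the subbase contains in
  any case. Discarding this seminorm makes the normalisation \<open>p e = 1\<close>
  possible.\<close>

lemma seminorm_topology_remove_zero: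
  "seminorm_topology (P - {\<lambda>_. 0}) = seminorm_topology P"
proof -
  have "insert UNIV {{y. p (y - x) < r} | p x r. p \<in> P - {\<lambda>_. 0} \<and> 0 < r} =
      insert UNIV {{y. p (y - x) < r} | p x r. p \<in> P \<and> 0 < r}"
  proof (intro equalityI subsetI)
    fix V assume V: "V \<in> insert UNIV {{y. p (y - x) < r} | p x r. p \<in> P \<and> 0 < r}"
    show "V \<in> insert UNIV {{y. p (y - x) < r} | p x r. p \<in> P - {\<lambda>_. 0} \<and> 0 < r}"
    proof (cases "V = UNIV")
      case False
      with V obtain p x r where "V = {y. p (y - x) < r}" "p \<in> P" "0 < r" by auto
      moreover from this False have "p \<noteq> (\<lambda>_. 0)" by auto
      ultimately show ?thesis by blast
    qed simp
  qed blast
  then show ?thesis by (simp only: seminorm_topology_def)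
qed

section \<open>Equivalence of uniformity and norming characters\<close>

theorem theorem2p1:
  fixes smul :: "complex \<Rightarrow> 'a::ring \<Rightarrow> 'a"
    and T :: "'a topology"
    and e :: 'a
  assumes "topological_algebra smul T"
    and "\<And>x. e * x = x"
    and "\<And>x. x * e = x"
  shows "uniform_topological_algebra smul T \<longleftrightarrow>
    (\<exists>P. (\<forall>p\<in>P. submultiplicative_seminorm smul p) \<and>
         T = seminorm_topology P \<and>
         (\<forall>p\<in>P. p e = 1) \<and>
         (\<forall>x. \<forall>p\<in>P. p x = 1 \<longrightarrow>
            (\<exists>f\<in>characters_bounded_by smul T p. cmod (f x) = 1)))"
proof -
  interpret topological_algebra smul T by (rule assms)
  interpret unital_complex_algebra smul e by unfold_locales (rule assms)+
  show ?thesis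
  proof
    assume "uniform_topological_algebra smul T"
    then obtain P where P: "\<And>p. p \<in> P \<Longrightarrow> uniform_seminorm smul p" "T = seminorm_topology P"
      by (auto simp: uniform_topological_algebra_def)
    let ?P = "P - {\<lambda>_. 0}"
    have T: "T = seminorm_topology ?P"
      by (simp only: P(2) seminorm_topology_remove_zero)
    have norm: "normalized_uniform_seminorm smul e p" if p: "p \<in> ?P" for p
    proof -
      interpret p: algebra_uniform_seminorm smul e p
        using P(1) [of p] p by unfold_locales (auto simp: uniform_seminorm_def)
      obtain x where "p x \<noteq> 0" using p by auto
      \<comment> \<open>If \<open>p e\<close> were 0, then \<open>e * x = x\<close> would be null;
        and \<open>p e\<close> equals its own square, which leaves only 1.\<close>
      then have "p e \<noteq> 0"
        using p.null_mult(1) [of e x] by auto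
      then have "p e = 1"
        using p.square [of e] by (simp add: power2_eq_square)
      then show ?thesis by unfold_locales
    qed
    have "submultiplicative_seminorm smul p \<and> p e = 1 \<and>
        (\<forall>x. p x = 1 \<longrightarrow> (\<exists>f\<in>characters_bounded_by smul T p. cmod (f x) = 1))" if p: "p \<in> ?P" for p
    proof (intro conjI allI impI)
      interpret p: normalized_uniform_seminorm smul e p by (rule norm [OF p])
      show "submultiplicative_seminorm smul p"
        by (simp add: submultiplicative_seminorm_def p.seminorm p.submultiplicative)
      show "p e = 1" by simp
      fix x assume "p x = 1"
      then obtain q where q: "multiplicative_seminorm smul e q" "\<And>y. q y \<le> p y" "q x = 1"
        using p.ex_norming_multiplicative_seminorm by blast
      then obtain f where f: "Vector_Spaces.linear smul (*) f" "\<And>x y. f (x * y) = f x * f y"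
          "f e = 1" "\<And>y. cmod (f y) = q y"
        using multiplicative_seminorm.ex_character by blast
      have le: "cmod (f y) \<le> p y" for y using f(4) q(2) by simp
      have "continuous_map T euclidean f"
        unfolding T by (rule p.continuous_map_if_le_seminorm [OF f(1) le p])
      then have "f \<in> characters_bounded_by smul T p"
        using f le by (auto simp: characters_bounded_by_def characters_def intro!: exI [of _ e])
      then show "\<exists>f\<in>characters_bounded_by smul T p. cmod (f x) = 1"
        using f(4) [of x] q(3) by (intro bexI [of _ f]) simp_all
    qed
    then show "\<exists>P. (\<forall>p\<in>P. submultiplicative_seminorm smul p) \<and> T = seminorm_topology P \<and>
        (\<forall>p\<in>P. p e = 1) \<and>
        (\<forall>x. \<forall>p\<in>P. p x = 1 \<longrightarrow> (\<exists>f\<in>characters_bounded_by smul T p. cmod (f x) = 1))"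
      using T by (intro exI [of _ ?P]) blast
  next
    assume "\<exists>P. (\<forall>p\<in>P. submultiplicative_seminorm smul p) \<and> T = seminorm_topology P \<and>
        (\<forall>p\<in>P. p e = 1) \<and>
        (\<forall>x. \<forall>p\<in>P. p x = 1 \<longrightarrow> (\<exists>f\<in>characters_bounded_by smul T p. cmod (f x) = 1))"
    then obtain P where P: "\<And>p. p \<in> P \<Longrightarrow> submultiplicative_seminorm smul p" "T = seminorm_topology P"
      "\<And>x p. p \<in> P \<Longrightarrow> p x = 1 \<Longrightarrow> \<exists>f\<in>characters_bounded_by smul T p. cmod (f x) = 1"
      by blast
    have "uniform_seminorm smul p" if p: "p \<in> P" for p
    proof -
      interpret p: algebra_seminorm smul e p
        using P(1) [OF p] by unfold_locales (simp add: submultiplicative_seminorm_def)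
      have product: "p (y * w) \<le> p y * p w" for y w
        using P(1) [OF p] by (simp add: submultiplicative_seminorm_def)
      have "p (x * x) = (p x)\<^sup>2" for x
      proof (cases "p x = 0")
        case True
        then show ?thesis using product [of x x] p.nonneg [of "x * x"] by simp
      next
        case False
        \<comment> \<open>Scaling brings \<open>x\<close> to seminorm 1, where a norming character
          is available; its multiplicativity bounds the seminorm of the square from below by
          1.\<close>
        define c where "c = complex_of_real (1 / p x)"
        have "p (smul c x) = 1"
          using False by (simp add: p.homogeneous c_def norm_divide)
        then obtain f where f: "f \<in> characters_bounded_by smul T p" "cmod (f (smul c x)) = 1"
          using P(3) [OF p] by blast
        have "1 = cmod (f (smul c x * smul c x))"
          using f by (simp add: characters_bounded_by_def characters_def norm_mult)
        also have "\<dots> \<le> p (smul c x * smul c x)"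
          using f(1) by (simp add: characters_bounded_by_def)
        also have "\<dots> = p (x * x) / (p x)\<^sup>2"
          by (simp add: smul_mult p.homogeneous c_def norm_divide norm_mult power2_eq_square)
        finally have "(p x)\<^sup>2 \<le> p (x * x)"
          using False by (simp add: field_simps)
        then show ?thesis
          using product [of x x] by (simp add: power2_eq_square)
      qed
      then show ?thesis by (simp add: uniform_seminorm_def p.seminorm)
    qed
    then show "uniform_topological_algebra smul T"
      using P(2) assms(1) by (auto simp: uniform_topological_algebra_def)
  qed
qed

end
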